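(* Let $X,Y\subset\mathbb{C}$. If $X$ and $Y$ have the same cardinality, then the groups $B_X$ and $B_Y$ are isomorphic.
   Context: Let $\mathbb{I}=[0,1]$. For $X\subset\mathbb{C}$, $\mathbb{C}^X$ is the product space (product topology) and $F_X=\{u\in\mathbb{C}^X : u(x)\neq u(y)\text{ for all distinct }x,y\in X\}$ with the subspace topology. A path in a space is a continuous map from $\mathbb{I}$; $f\cdot g$ denotes concatenation of paths (first $f$, then $g$); $f\sim g$ means homotopic relative to $\{0,1\}$. $\Sigma_X$ is the set of all permutations of the set $X$; since $X\subset\mathbb{C}$, $\Sigma_X\subset F_X$. For a path $f$ in $F_X$ and $\sigma\in\Sigma_X$, $f^\sigma(t)(x)=f(t)(\sigma(x))$. An $X$-braid is a path $f:\mathbb{I}\to F_X$ with $f(0)=\mathrm{id}_X$ and $f(1)\in\Sigma_X$. $A_X$ is the set of $X$-braids, $[f]$ is the class of $f\in A_X$ under $\sim$, and $B_X=\{[f]:f\in A_X\}$, which is a group under $[f][g]=[f\cdot g^{f(1)}]$. *)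

theory Defs
  imports "HOL-Analysis.Analysis" "HOL-Library.Equipollence" "HOL-Algebra.Bij"
begin

text \<open>
  A function \<open>X \<rightarrow> \<complex>\<close> is represented by the unique element of \<open>extensional X\<close> with the same values on \<open>X\<close>,
  as in \<open>product_topology\<close> and \<open>Bij\<close>.  Accordingly \<open>Bij X\<close> is the set of permutations of \<open>X\<close> and
  \<open>\<lambda>x\<in>X. x\<close> is the identity of \<open>X\<close>.
\<close>

definition config_space :: "complex set \<Rightarrow> (complex \<Rightarrow> complex) topology" where
  "config_space X = subtopology (product_topology (\<lambda>_. euclidean) X) {u. inj_on u X}"

text \<open>
  Paths are total functions on \<open>real\<close>, as for \<open>pathin\<close>.  Their values outside the unit interval
  are irrelevant: paths that agree on the unit interval are homotopic in the sense below.
\<close>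

definition path_hom :: "'a topology \<Rightarrow> (real \<Rightarrow> 'a) \<Rightarrow> (real \<Rightarrow> 'a) \<Rightarrow> bool" where
  "path_hom T f g \<longleftrightarrow>
     homotopic_with (\<lambda>h. h 0 = f 0 \<and> h 1 = f 1) (top_of_set {0..1}) T f g"

definition path_perm ::
    "complex set \<Rightarrow> (real \<Rightarrow> complex \<Rightarrow> complex) \<Rightarrow> (complex \<Rightarrow> complex) \<Rightarrow> real \<Rightarrow> complex \<Rightarrow> complex" where
  "path_perm X f \<sigma> = (\<lambda>t. \<lambda>x\<in>X. f t (\<sigma> x))"

definition braids :: "complex set \<Rightarrow> (real \<Rightarrow> complex \<Rightarrow> complex) set" where
  "braids X = {f. pathin (config_space X) f \<and> f 0 = (\<lambda>x\<in>X. x) \<and> f 1 \<in> Bij X}"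

definition braid_class ::
    "complex set \<Rightarrow> (real \<Rightarrow> complex \<Rightarrow> complex) \<Rightarrow> (real \<Rightarrow> complex \<Rightarrow> complex) set" where
  "braid_class X f = {g \<in> braids X. path_hom (config_space X) f g}"

text \<open>
  The union in the multiplication is over all representatives \<open>f\<close> and \<open>g\<close> of the two classes; it
  is a union of equal classes (\<open>mult_braid_class\<close> below).
\<close>

definition braid_group :: "complex set \<Rightarrow> (real \<Rightarrow> complex \<Rightarrow> complex) set monoid" where
  "braid_group X =
     \<lparr>carrier = braid_class X ` braids X,
      mult = (\<lambda>P Q. \<Union>f\<in>P. \<Union>g\<in>Q. braid_class X (f +++ path_perm X g (f 1))),
      one = braid_class X (\<lambda>t. \<lambda>x\<in>X. x)\<rparr>"

text \<open>
  Outside \<open>X\<close> all members of \<open>extensional X\<close> agree, so \<open>config_space X\<close> is also a subspace of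
  the type \<open>complex \<Rightarrow> complex\<close>, and the class-based theory of \<open>homotopic_paths\<close> applies to it.
\<close>

definition config_set :: "complex set \<Rightarrow> (complex \<Rightarrow> complex) set" where
  "config_set X = {u \<in> extensional X. inj_on u X}"

lemma product_topology_eq_top_of_set:
  "product_topology (\<lambda>_. euclidean) X =
    (top_of_set (extensional X) :: ('a \<Rightarrow> 'b::topological_space) topology)"
    (is "?P = ?S")
proof -
  have ts: "topspace ?P = extensional X"
    by (simp add: PiE_def)
  have 1: "continuous_map ?S ?P (\<lambda>u. u)"
  proof -
    have "continuous_map ?S euclidean (\<lambda>u. u k)" for k
      by (simp add: continuous_on_subset[OF continuous_on_product_coordinates subset_UNIV])
    then show ?thesis
      by (auto simp: continuous_map_componentwise)
  qed
  have 2: "continuous_map ?P ?S (\<lambda>u. u)"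
  proof -
    have "continuous_map ?P euclidean (\<lambda>u. u k)" for k
    proof (cases "k \<in> X")
      case True
      then show ?thesis by (rule continuous_map_product_projection)
    next
      case False
      have "continuous_map ?P euclidean (\<lambda>u. undefined :: 'b)" by simp
      then show ?thesis
        by (rule continuous_map_eq) (use ts False in \<open>auto simp: extensional_def\<close>)
    qed
    then have "continuous_map ?P (product_topology (\<lambda>_. euclidean) UNIV) (\<lambda>u. u)"
      by (auto simp: continuous_map_componentwise)
    then show ?thesis
      using ts by (auto simp: euclidean_product_topology continuous_map_in_subtopology)
  qed
  have "homeomorphic_map ?P ?S (\<lambda>u. u)"
    unfolding homeomorphic_map_maps homeomorphic_maps_def using 1 2 by auto
  then have "openin ?P U \<longleftrightarrow> openin ?S U" for U
    using 1 2 ts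
    by (smt (verit, best) homeomorphic_map_openness_eq image_ident openin_subset topspace_euclidean_subtopology)
  then show ?thesis by (simp add: topology_eq)
qed

lemma config_space_eq: "config_space X = top_of_set (config_set X)"
  by (simp add: config_space_def product_topology_eq_top_of_set subtopology_subtopology
      config_set_def Collect_conj_eq)

lemma path_hom_config_space:
  "path_hom (config_space X) f g \<longleftrightarrow> homotopic_paths (config_set X) f g"
  by (simp add: path_hom_def config_space_eq homotopic_paths_def pathstart_def pathfinish_def)

lemma braids_iff:
  "f \<in> braids X \<longleftrightarrow> path f \<and> path_image f \<subseteq> config_set X \<and>
     pathstart f = (\<lambda>x\<in>X. x) \<and> pathfinish f \<in> Bij X"
  by (auto simp: braids_def config_space_eq pathin_canon_iff path_image_def pathstart_def
      pathfinish_def)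

lemma perm_comp_config_set:
  assumes "u \<in> config_set X" "\<sigma> \<in> Bij X" shows "compose X u \<sigma> \<in> config_set X"
  using assms comp_inj_on[of \<sigma> X u]
  by (auto simp: config_set_def Bij_def bij_betw_def compose_def inj_on_def)

lemma continuous_on_compose_right:
  "continuous_on S (\<lambda>u::complex \<Rightarrow> complex. compose X u \<sigma>)"
proof (rule continuous_on_coordinatewise_then_product)
  fix k
  show "continuous_on S (\<lambda>u::complex \<Rightarrow> complex. compose X u \<sigma> k)"
  proof (cases "k \<in> X")
    case True
    then show ?thesis
      using continuous_on_subset[OF continuous_on_product_coordinates[of "\<sigma> k"]]
      by (auto simp: compose_def)
  qed (simp add: compose_def)
qed

lemma path_perm_eq: "path_perm X f \<sigma> = (\<lambda>u. compose X u \<sigma>) \<circ> f"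
  by (simp add: path_perm_def compose_def fun_eq_iff)

lemma homotopic_paths_path_perm:
  assumes "homotopic_paths (config_set X) f g" "\<sigma> \<in> Bij X"
  shows "homotopic_paths (config_set X) (path_perm X f \<sigma>) (path_perm X g \<sigma>)"
  unfolding path_perm_eq
  by (rule homotopic_paths_continuous_image[OF assms(1)])
    (use assms(2) in \<open>auto intro: continuous_on_compose_right perm_comp_config_set\<close>)

lemma path_path_perm: "path f \<Longrightarrow> path (path_perm X f \<sigma>)"
  unfolding path_perm_eq by (rule path_continuous_image) (auto intro: continuous_on_compose_right)

lemma path_image_path_perm:
  "path_image f \<subseteq> config_set X \<Longrightarrow> \<sigma> \<in> Bij X \<Longrightarrow> path_image (path_perm X f \<sigma>) \<subseteq> config_set X"
  by (auto simp: path_image_def path_perm_eq intro: perm_comp_config_set)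

lemma pathstart_path_perm: "pathstart (path_perm X f \<sigma>) = compose X (pathstart f) \<sigma>"
  by (simp add: path_perm_eq pathstart_def)

lemma pathfinish_path_perm: "pathfinish (path_perm X f \<sigma>) = compose X (pathfinish f) \<sigma>"
  by (simp add: path_perm_eq pathfinish_def)

lemma pathstart_path_perm_braid:
  "g \<in> braids X \<Longrightarrow> \<sigma> \<in> Bij X \<Longrightarrow> pathstart (path_perm X g \<sigma>) = \<sigma>"
  by (simp add: pathstart_path_perm braids_iff Bij_imp_funcset Bij_imp_extensional)

lemma join_braids:
  assumes "f \<in> braids X" "g \<in> braids X"
  shows "f +++ path_perm X g (f 1) \<in> braids X"
proof -
  have s: "f 1 \<in> Bij X" using assms by (simp add: braids_def)
  have "pathfinish f = pathstart (path_perm X g (f 1))"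
    using pathstart_path_perm_braid[OF assms(2) s] by (simp add: pathfinish_def)
  then show ?thesis
    using assms s path_path_perm[of g X "f 1"] path_image_path_perm[of g X "f 1"]
      compose_Bij[OF _ s, of "pathfinish g"]
    by (simp add: braids_iff pathfinish_path_perm path_image_join)
qed

lemma braid_class_eq_iff:
  assumes "f \<in> braids X" "g \<in> braids X"
  shows "braid_class X f = braid_class X g \<longleftrightarrow> homotopic_paths (config_set X) f g"
proof
  assume *: "braid_class X f = braid_class X g"
  have "g \<in> braid_class X g"
    using assms by (simp add: braid_class_def path_hom_config_space braids_iff)
  then show "homotopic_paths (config_set X) f g"
    unfolding *[symmetric] by (simp add: braid_class_def path_hom_config_space)
next
  assume "homotopic_paths (config_set X) f g"
  then show "braid_class X f = braid_class X g"
    unfolding braid_class_def path_hom_config_space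
    by (metis (mono_tags, lifting) homotopic_paths_sym homotopic_paths_trans)
qed

lemma mult_braid_class:
  assumes f: "f \<in> braids X" and g: "g \<in> braids X"
  shows "braid_class X f \<otimes>\<^bsub>braid_group X\<^esub> braid_class X g =
    braid_class X (f +++ path_perm X g (f 1))"
proof -
  have eq: "braid_class X (f' +++ path_perm X g' (f' 1)) = braid_class X (f +++ path_perm X g (f 1))"
    if f': "f' \<in> braid_class X f" and g': "g' \<in> braid_class X g" for f' g'
  proof -
    have *: "f' \<in> braids X" "g' \<in> braids X"
      "homotopic_paths (config_set X) f f'" "homotopic_paths (config_set X) g g'"
      using f' g' by (auto simp: braid_class_def path_hom_config_space)
    have 1: "f' 1 = f 1"
      using homotopic_paths_imp_pathfinish[OF *(3)] by (simp add: pathfinish_def)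
    have s: "f 1 \<in> Bij X" using f by (simp add: braids_def)
    have "homotopic_paths (config_set X) (f +++ path_perm X g (f 1)) (f' +++ path_perm X g' (f 1))"
      using pathstart_path_perm_braid[OF g s]
      by (intro homotopic_paths_join *(3) homotopic_paths_path_perm *(4) s)
        (simp add: pathfinish_def)
    then show ?thesis
      using braid_class_eq_iff[OF join_braids[OF f g] join_braids[OF *(1,2)]] 1 by simp
  qed
  have "f \<in> braid_class X f" "g \<in> braid_class X g"
    using f g by (auto simp: braid_class_def path_hom_config_space braids_iff)
  then have ne: "braid_class X f \<noteq> {}" "braid_class X g \<noteq> {}" by blast+
  have "(\<Union>f'\<in>braid_class X f. \<Union>g'\<in>braid_class X g. braid_class X (f' +++ path_perm X g' (f' 1))) =
    (\<Union>f'\<in>braid_class X f. \<Union>g'\<in>braid_class X g. braid_class X (f +++ path_perm X g (f 1)))"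
    by (intro SUP_cong refl eq)
  also have "\<dots> = braid_class X (f +++ path_perm X g (f 1))"
    using ne by simp
  finally show ?thesis by (simp add: braid_group_def)
qed

lemma const_braid: "(\<lambda>t. \<lambda>x\<in>X. x) \<in> braids X"
  by (auto simp: braids_def config_space_eq config_set_def inj_on_def id_Bij)

lemma path_perm_join: "path_perm X (f +++ g) \<sigma> = path_perm X f \<sigma> +++ path_perm X g \<sigma>"
  by (simp add: path_perm_eq path_compose_join)

lemma path_perm_path_perm:
  "\<tau> \<in> Bij X \<Longrightarrow> path_perm X (path_perm X f \<sigma>) \<tau> = path_perm X f (compose X \<sigma> \<tau>)"
  using Bij_imp_funcset[of \<tau> X]
  by (simp add: path_perm_def compose_def fun_eq_iff Pi_iff restrict_def)

lemma path_perm_id: "g \<in> braids X \<Longrightarrow> homotopic_paths (config_set X) (path_perm X g (\<lambda>x\<in>X. x)) g"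
proof (rule homotopic_paths_eq)
  assume g: "g \<in> braids X"
  then show "path (path_perm X g (\<lambda>x\<in>X. x))"
    "path_image (path_perm X g (\<lambda>x\<in>X. x)) \<subseteq> config_set X"
    by (simp_all add: braids_iff path_path_perm path_image_path_perm[OF _ id_Bij])
  show "path_perm X g (\<lambda>x\<in>X. x) t = g t" if "t \<in> {0..1}" for t
  proof -
    have "g t \<in> extensional X"
      using g that by (simp add: braids_iff path_image_def config_set_def image_subset_iff)
    then show ?thesis
      by (auto simp: path_perm_def fun_eq_iff extensional_def)
  qed
qed

lemma homotopic_paths_reversepath_join:
  fixes p :: "real \<Rightarrow> 'a::topological_space"
  assumes "path p" "path_image p \<subseteq> S"
  shows "homotopic_paths S (reversepath p +++ p) (\<lambda>t. pathfinish p)"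
proof -
  define w :: "real \<times> real \<Rightarrow> real" where "w = (\<lambda>(s,t). 1 - (1 - s) * min (2*t) (2 - 2*t))"
  have w: "w y \<in> {0..1}" if "y \<in> {0..1} \<times> {0..1}" for y
  proof -
    obtain s t where y: "y = (s,t)" by (cases y)
    have "0 \<le> (1 - s) * min (2*t) (2 - 2*t)" "(1 - s) * min (2*t) (2 - 2*t) \<le> 1"
      using that by (auto simp: y intro!: mult_nonneg_nonneg mult_le_one)
    then show ?thesis by (simp add: w_def y)
  qed
  have cw: "continuous_on A w" for A
    unfolding w_def case_prod_beta by (intro continuous_intros)
  have cp: "continuous_on {0..1} p" using assms(1) by (simp add: path_def)
  show ?thesis
    unfolding homotopic_paths
  proof (intro exI conjI ballI)
    show "continuous_on ({0..1} \<times> {0..1}) (p \<circ> w)"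
      using w by (intro continuous_on_compose cw continuous_on_subset[OF cp]) auto
    show "p \<circ> w \<in> {0..1} \<times> {0..1} \<rightarrow> S"
      using assms(2) w by (auto simp: path_image_def image_subset_iff)
    show "(p \<circ> w) (0, t) = (reversepath p +++ p) t" for t
      by (auto simp: w_def joinpaths_def reversepath_def min_def algebra_simps)
  qed (auto simp: w_def pathstart_def pathfinish_def joinpaths_def reversepath_def)
qed

lemma group_braid_group: "group (braid_group X)"
proof (rule groupI)
  let ?S = "config_set X" and ?i = "\<lambda>x\<in>X. x"
  have car: "carrier (braid_group X) = braid_class X ` braids X"
    and one: "\<one>\<^bsub>braid_group X\<^esub> = braid_class X (\<lambda>t. ?i)"
    by (simp_all add: braid_group_def)
  show "\<one>\<^bsub>braid_group X\<^esub> \<in> carrier (braid_group X)"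
    using const_braid by (simp add: car one)
  show "P \<otimes>\<^bsub>braid_group X\<^esub> Q \<in> carrier (braid_group X)"
    if "P \<in> carrier (braid_group X)" "Q \<in> carrier (braid_group X)" for P Q
    using that by (auto simp: car mult_braid_class join_braids)
  show "P \<otimes>\<^bsub>braid_group X\<^esub> Q \<otimes>\<^bsub>braid_group X\<^esub> R = P \<otimes>\<^bsub>braid_group X\<^esub> (Q \<otimes>\<^bsub>braid_group X\<^esub> R)"
    if PQR: "P \<in> carrier (braid_group X)" "Q \<in> carrier (braid_group X)" "R \<in> carrier (braid_group X)"
    for P Q R
  proof -
    obtain f g h where f: "f \<in> braids X" and g: "g \<in> braids X" and h: "h \<in> braids X"
      and P: "P = braid_class X f" and Q: "Q = braid_class X g" and R: "R = braid_class X h"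
      using PQR by (auto simp: car)
    have s: "f 1 \<in> Bij X" and t: "g 1 \<in> Bij X" using f g by (auto simp: braids_def)
    let ?g = "path_perm X g (f 1)" and ?h = "path_perm X h (compose X (g 1) (f 1))"
    have 1: "(f +++ ?g) 1 = compose X (g 1) (f 1)"
      by (simp add: joinpaths_def path_perm_eq)
    have 2: "path_perm X (g +++ path_perm X h (g 1)) (f 1) = ?g +++ ?h"
      by (simp add: path_perm_join path_perm_path_perm s)
    have st: "compose X (g 1) (f 1) \<in> Bij X" using s t by (rule compose_Bij[rotated])
    have ends: "pathfinish f = pathstart ?g" "pathfinish ?g = pathstart ?h"
      using pathstart_path_perm_braid[OF g s] pathstart_path_perm_braid[OF h st]
        pathfinish_path_perm[of X g "f 1"]
      by (simp_all add: pathfinish_def)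
    have "homotopic_paths ?S (f +++ (?g +++ ?h)) ((f +++ ?g) +++ ?h)"
      by (rule homotopic_paths_assoc)
        (use f g h s st ends path_image_path_perm in \<open>auto simp: braids_iff path_path_perm\<close>)
    then show ?thesis
      unfolding P Q R
      using braid_class_eq_iff[OF join_braids[OF join_braids[OF f g] h] join_braids[OF f join_braids[OF g h]]]
      by (simp add: mult_braid_class f g h join_braids 1 2 homotopic_paths_sym)
  qed
  show "\<one>\<^bsub>braid_group X\<^esub> \<otimes>\<^bsub>braid_group X\<^esub> P = P" if P_car: "P \<in> carrier (braid_group X)" for P
  proof -
    obtain f where f: "f \<in> braids X" and P: "P = braid_class X f"
      using P_car by (auto simp: car)
    have fS: "path f" "path_image f \<subseteq> ?S" "pathstart f = ?i" using f by (auto simp: braids_iff)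
    have "homotopic_paths ?S ((\<lambda>t. ?i) +++ path_perm X f ?i) ((\<lambda>t. ?i) +++ f)"
      using const_braid[of X] pathstart_path_perm_braid[OF f id_Bij] path_perm_id[OF f]
      by (intro homotopic_paths_join) (auto simp: braids_iff pathfinish_def)
    also have "homotopic_paths ?S ((\<lambda>t. ?i) +++ f) f"
    proof -
      have "homotopic_paths ?S f ((\<lambda>t. ?i) +++ f)"
      proof (rule homotopic_paths_reparametrize[OF fS(1,2), of "\<lambda>t. max 0 (2*t - 1)"])
        show "continuous_on {0..1} (\<lambda>t::real. max 0 (2*t - 1))"
          by (intro continuous_intros)
        show "(\<lambda>t::real. max 0 (2*t - 1)) \<in> {0..1} \<rightarrow> {0..1}" by (auto simp: max_def)
        show "((\<lambda>t. ?i) +++ f) t = f (max 0 (2*t - 1))" for t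
        proof (cases "t \<le> 1/2")
          case True
          then have "max 0 (2*t - 1) = 0" by (simp add: max_def)
          then show ?thesis using True fS(3) by (simp add: joinpaths_def pathstart_def)
        next
          case False
          then have "max 0 (2*t - 1) = 2*t - 1" by (simp add: max_def)
          then show ?thesis using False by (simp add: joinpaths_def)
        qed
      qed simp_all
      then show ?thesis by (rule homotopic_paths_sym)
    qed
    finally have "homotopic_paths ?S ((\<lambda>t. ?i) +++ path_perm X f ?i) f" .
    then show ?thesis
      using braid_class_eq_iff[OF join_braids[OF const_braid f] f]
      by (simp add: P one mult_braid_class const_braid f)
  qed
  show "\<exists>Q\<in>carrier (braid_group X). Q \<otimes>\<^bsub>braid_group X\<^esub> P = \<one>\<^bsub>braid_group X\<^esub>"
    if P_car: "P \<in> carrier (braid_group X)" for P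
  proof -
    obtain f where f: "f \<in> braids X" and P: "P = braid_class X f"
      using P_car by (auto simp: car)
    define s where "s = restrict (inv_into X (f 1)) X"
    have f1: "f 1 \<in> Bij X" using f by (simp add: braids_def)
    have s: "s \<in> Bij X" unfolding s_def using f1 by (rule restrict_inv_into_Bij)
    have inv: "compose X (f 1) s = ?i"
      using f1 unfolding s_def Bij_def by (auto simp: bij_betw_def intro!: compose_id_inv_into)
    let ?p = "path_perm X f s"
    let ?g = "reversepath ?p"
    have ps: "pathstart ?p = s" by (rule pathstart_path_perm_braid[OF f s])
    have pf: "pathfinish ?p = ?i"
      using inv by (simp add: pathfinish_path_perm) (simp add: pathfinish_def)
    have pS: "path ?p" "path_image ?p \<subseteq> ?S"
      using f s path_image_path_perm by (auto simp: braids_iff path_path_perm)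
    have g: "?g \<in> braids X"
      using ps pf pS s by (simp add: braids_iff)
    have g1: "?g 1 = s" using ps by (simp add: reversepath_def pathstart_def)
    have "homotopic_paths ?S (?g +++ ?p) (\<lambda>t. ?i)"
      using homotopic_paths_reversepath_join[OF pS] pf by simp
    then have "braid_class X ?g \<otimes>\<^bsub>braid_group X\<^esub> P = \<one>\<^bsub>braid_group X\<^esub>"
      using braid_class_eq_iff[OF join_braids[OF g f] const_braid]
      by (simp add: P one mult_braid_class g f g1)
    then show ?thesis using g by (auto simp: car)
  qed
qed

end

theory Submission
  imports Defs
begin

text \<open>
  Two ideas carry the proof: any two points of \<open>config_set X\<close> are joined by a path, and
  conjugating by such a path moves braids from one base point to another.

  Let \<open>\<phi>\<close> be a bijection from \<open>X\<close> to \<open>Y\<close>.  As an injective function on \<open>X\<close> it is a point of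
  \<open>config_set X\<close>, and so is the identity.  Given a path \<open>h\<close> from the identity to \<open>\<phi>\<close>, a braid \<open>f\<close>
  on \<open>X\<close> that ends in the permutation \<open>\<sigma>\<close> yields the path that runs back along \<open>h\<close>, along \<open>f\<close>,
  and then along the permuted path of \<open>h\<close>, from \<open>\<sigma>\<close> to \<open>\<phi> \<circ> \<sigma>\<close>.  It leads from \<open>\<phi>\<close> to \<open>\<phi> \<circ> \<sigma>\<close>;
  relabelling the strands by \<open>Y\<close> through the inverse of \<open>\<phi>\<close> makes it a braid on \<open>Y\<close> that ends in the
  permutation conjugate to \<open>\<sigma>\<close>.  In a product of two such braids the inner copies of \<open>h\<close> cancel up
  to homotopy, so this is a homomorphism on classes, and both steps, conjugation and
  relabelling, can be undone.

  The path \<open>h\<close> is the substantial point (\<open>path_connected_config_set\<close>), because \<open>X\<close> may be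
  uncountable and \<open>\<phi>\<close> has no regularity.  A path in \<open>config_set X\<close> is just a family of
  continuous curves, one for each \<open>x \<in> X\<close>, no two of which are ever at the same place at the same
  time.  The curve of \<open>x\<close> is taken from a family with one real parameter, of curves with given
  ends, chosen so that a member of one family meets only finitely many members of a family with
  other starting and end points.  The parameters
  are then chosen by transfinite recursion along a well-order of \<open>X\<close> whose proper initial segments
  have fewer than continuum many elements: at each stage the forbidden parameters are a union of
  fewer than continuum many finite sets, hence do not exhaust the reals.
\<close>

unbundle cardinal_syntax

section \<open>Choosing one parameter for each point\<close>

text \<open>
  The values are chosen by recursion along the cardinal well-order of \<open>X\<close>.  When \<open>x\<close> is reached,
  each of its predecessors forbids finitely many values, and there are strictly fewer predecessors
  than elements of \<open>'b\<close>; so some value is left.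
\<close>

lemma exists_conflict_free_choice:
  fixes C :: "'a \<Rightarrow> 'a \<Rightarrow> 'b \<Rightarrow> 'b \<Rightarrow> bool"
  assumes small: "|X| \<le>o |UNIV :: 'b set|"
    and inf: "infinite (UNIV :: 'b set)"
    and sym: "\<And>x y s r. C x y s r \<Longrightarrow> C y x r s"
    and fin: "\<And>x y r. x \<in> X \<Longrightarrow> y \<in> X \<Longrightarrow> x \<noteq> y \<Longrightarrow> finite {s. C x y s r}"
  shows "\<exists>f. \<forall>x\<in>X. \<forall>y\<in>X. x \<noteq> y \<longrightarrow> \<not> C x y (f x) (f y)"
proof -
  let ?r = "|X|"
  have wo: "Well_order ?r" by (rule card_of_Well_order)
  have "\<exists>f. \<forall>x. x \<in> X \<longrightarrow> (\<forall>y. (y, x) \<in> ?r - Id \<longrightarrow> \<not> C x y (f x) (f y))"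
  proof (rule dependent_wf_choice[where P = "\<lambda>f x s. x \<in> X \<longrightarrow>
      (\<forall>y. (y, x) \<in> ?r - Id \<longrightarrow> \<not> C x y s (f y))"])
    show "wf (?r - Id)" using wo by (simp add: well_order_on_def)
    show "\<exists>s. x \<in> X \<longrightarrow> (\<forall>y. (y, x) \<in> ?r - Id \<longrightarrow> \<not> C x y s (f y))" for x f
    proof (cases "x \<in> X")
      case True
      define B where "B = (\<Union>y\<in>underS ?r x. {s. C x y s (f y)})"
      have und: "y \<in> X" "y \<noteq> x" if "y \<in> underS ?r x" for y
        using that FieldI1[of y x ?r] by (auto simp: underS_def Field_card_of)
      have finB: "finite {s. C x y s (f y)}" if "y \<in> underS ?r x" for y
        using fin[OF True und(1)[OF that]] und(2)[OF that] by blast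
      have lt: "|underS ?r x| <o |UNIV :: 'b set|"
        using card_of_underS[OF card_of_Card_order] True small
        by (metis Field_card_of ordLess_ordLeq_trans)
      \<comment> \<open>The case split is needed because finite sets indexed by a finite initial segment may have
        a union larger than the segment.\<close>
      have "B \<noteq> UNIV"
      proof (cases "finite (underS ?r x)")
        case True
        then have "finite B" unfolding B_def using finB by blast
        then show ?thesis using inf by blast
      next
        case False
        have "|{s. C x y s (f y)}| \<le>o |underS ?r x|" if "y \<in> underS ?r x" for y
          using finB[OF that] False
          by (meson card_of_Well_order card_of_ordLeq_infinite ordLeq_total)
        then have "|B| \<le>o |underS ?r x|"
          unfolding B_def using False
          by (intro card_of_UNION_ordLeq_infinite) (auto intro: ordLeq_refl card_of_Card_order)
        then have "|B| <o |UNIV :: 'b set|" using lt by (rule ordLeq_ordLess_trans)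
        then show ?thesis using ordLess_irreflexive by blast
      qed
      then obtain s where "s \<notin> B" by blast
      then have "\<forall>y. (y, x) \<in> ?r - Id \<longrightarrow> \<not> C x y s (f y)"
        by (auto simp: B_def underS_def)
      then show ?thesis by blast
    qed simp
  qed auto
  then obtain f where f: "\<And>x y. x \<in> X \<Longrightarrow> (y, x) \<in> ?r \<Longrightarrow> y \<noteq> x \<Longrightarrow> \<not> C x y (f x) (f y)"
    by blast
  have "total_on X ?r"
    using wo by (simp add: Field_card_of well_order_on_def linear_order_on_def)
  then have "\<forall>x\<in>X. \<forall>y\<in>X. x \<noteq> y \<longrightarrow> \<not> C x y (f x) (f y)"
    using f sym by (metis total_on_def)
  then show ?thesis by blast
qed

lemma card_of_complex_set_le_real: "|X :: complex set| \<le>o |UNIV :: real set|"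
proof -
  have inf: "infinite (UNIV :: real set)" by (rule infinite_UNIV_char_0)
  have "|UNIV :: complex set| \<le>o |(UNIV :: real set) \<times> (UNIV :: real set)|"
    by (rule card_of_ordLeqI[of "\<lambda>z. (Re z, Im z)"]) (auto simp: inj_on_def complex_eq_iff)
  also have "|(UNIV :: real set) \<times> (UNIV :: real set)| =o |UNIV :: real set|"
    by (rule card_of_Times_same_infinite[OF inf])
  finally show ?thesis using card_of_mono1[of X UNIV] ordLeq_transitive by blast
qed

section \<open>Path connectedness of configuration spaces\<close>

text \<open>
  The segment from \<open>a\<close> to \<open>b\<close>, pushed aside at time \<open>t\<close> by \<open>s t (1 - t)\<close> in the direction \<open>1 + \<i> t\<^sup>2\<close>.
  The parameter enters linearly, and the direction varies with time in such a way that a difference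
  \<open>(1 - t) d + t e\<close> of two segments is a real multiple of it at all times only if \<open>d = e = 0\<close>.
\<close>

definition bent_segment :: "complex \<Rightarrow> complex \<Rightarrow> real \<Rightarrow> real \<Rightarrow> complex" where
  "bent_segment a b s t =
     of_real (1 - t) * a + of_real t * b + of_real (s * t * (1 - t)) * Complex 1 (t\<^sup>2)"

lemma bent_segment_ends [simp]: "bent_segment a b s 0 = a" "bent_segment a b s 1 = b"
  by (simp_all add: bent_segment_def)

lemma continuous_on_bent_segment: "continuous_on A (bent_segment a b s)"
  unfolding bent_segment_def Complex_eq by (intro continuous_intros)

text \<open>
  A collision at time \<open>t\<close> determines \<open>s\<close>, so it suffices to bound the number of times \<open>t\<close>.  At such a
  time the difference \<open>(1 - t) d + t e\<close> of the two segments is a real multiple of the direction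
  \<open>1 + \<i> t\<^sup>2\<close>, that is, its imaginary part is \<open>t\<^sup>2\<close> times its real part.  This is a cubic equation in
  \<open>t\<close>, nontrivial because its coefficients of degree 0 and 2 are the imaginary part of \<open>d\<close> and minus
  the real part of \<open>d\<close>.
\<close>

lemma finite_bent_segment_collisions:
  assumes "a \<noteq> a'" "b \<noteq> b'"
  shows "finite {s. \<exists>t\<in>{0..1}. bent_segment a b s t = bent_segment a' b' s' t}"
proof -
  define d e where "d = a - a'" and "e = b - b'"
  define c where "c = (\<lambda>i::nat. if i = 0 then Im d else if i = 1 then Im e - Im d
    else if i = 2 then - Re d else Re d - Re e)"
  define T where "T = {t. (\<Sum>i\<le>3. c i * t ^ i) = 0}"
  have "\<exists>k\<le>3. c k \<noteq> 0"
  proof (cases "Im d = 0")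
    case True
    then have "c 2 \<noteq> 0" using assms(1) by (simp add: c_def d_def complex_eq_iff)
    then show ?thesis by (intro exI[of _ 2]) simp
  next
    case False
    then show ?thesis by (intro exI[of _ 0]) (simp add: c_def)
  qed
  then have finT: "finite T"
    unfolding T_def using polyfun_roots_finite[of c _ 3] by blast
  have "s \<in> (\<lambda>t. s' - ((1 - t) * Re d + t * Re e) / (t * (1 - t))) ` T"
    if t: "t \<in> {0..1}" and eq: "bent_segment a b s t = bent_segment a' b' s' t" for s t
  proof
    have t01: "t \<noteq> 0" "t \<noteq> 1" using eq assms by auto
    have re: "(1 - t) * Re d + t * Re e + (s - s') * (t * (1 - t)) = 0"
      and im: "(1 - t) * Im d + t * Im e + (s - s') * (t * (1 - t)) * t\<^sup>2 = 0"
      using arg_cong[OF eq, of Re] arg_cong[OF eq, of Im]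
      by (simp_all add: bent_segment_def d_def e_def algebra_simps)
    show "s = s' - ((1 - t) * Re d + t * Re e) / (t * (1 - t))"
      using re t01 by (simp add: divide_simps) algebra
    have "(\<Sum>i\<le>3. c i * t ^ i) = (1 - t) * Im d + t * Im e - t\<^sup>2 * ((1 - t) * Re d + t * Re e)"
      by (simp add: numeral_eq_Suc c_def algebra_simps)
    also have "\<dots> = 0" using re im by algebra
    finally show "t \<in> T" by (simp add: T_def)
  qed
  then have "{s. \<exists>t\<in>{0..1}. bent_segment a b s t = bent_segment a' b' s' t}
      \<subseteq> (\<lambda>t. s' - ((1 - t) * Re d + t * Re e) / (t * (1 - t))) ` T" by blast
  then show ?thesis using finT finite_surj by blast
qed

text \<open>
  Each coordinate moves along a bent segment from its value under \<open>u\<close> to its value under \<open>v\<close>;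
  injectivity of \<open>u\<close> and \<open>v\<close> gives the distinct ends that make collisions finite in number.
\<close>

theorem path_connected_config_set: "path_connected (config_set X)"
  unfolding path_connected_def
proof (intro ballI)
  fix u v assume u: "u \<in> config_set X" and v: "v \<in> config_set X"
  have "\<exists>s. \<forall>x\<in>X. \<forall>y\<in>X. x \<noteq> y \<longrightarrow>
    \<not> (\<exists>t\<in>{0..1}. bent_segment (u x) (v x) (s x) t = bent_segment (u y) (v y) (s y) t)"
  proof (rule exists_conflict_free_choice[where C = "\<lambda>x y s r.
      \<exists>t\<in>{0..1}. bent_segment (u x) (v x) s t = bent_segment (u y) (v y) r t"])
    show "|X| \<le>o |UNIV :: real set|" by (rule card_of_complex_set_le_real)
    show "infinite (UNIV :: real set)" by (rule infinite_UNIV_char_0)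
    show "finite {s. \<exists>t\<in>{0..1}. bent_segment (u x) (v x) s t = bent_segment (u y) (v y) r t}"
      if "x \<in> X" "y \<in> X" "x \<noteq> y" for x y r
      using u v that
      by (intro finite_bent_segment_collisions) (auto simp: config_set_def inj_on_def)
  qed metis
  then obtain s where s: "\<And>x y t. x \<in> X \<Longrightarrow> y \<in> X \<Longrightarrow> t \<in> {0..1} \<Longrightarrow>
      bent_segment (u x) (v x) (s x) t = bent_segment (u y) (v y) (s y) t \<Longrightarrow> x = y"
    by blast
  define h where "h t = (\<lambda>x\<in>X. bent_segment (u x) (v x) (s x) t)" for t
  have "path h"
    unfolding path_def
  proof (rule continuous_on_coordinatewise_then_product)
    fix x
    show "continuous_on {0..1} (\<lambda>t. h t x)"
      by (cases "x \<in> X") (simp_all add: h_def continuous_on_bent_segment)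
  qed
  moreover have "path_image h \<subseteq> config_set X"
    using s by (auto simp: path_image_def config_set_def h_def inj_on_def)
  moreover have "pathstart h = u" "pathfinish h = v"
    using u v by (auto simp: pathstart_def pathfinish_def h_def config_set_def extensional_restrict)
  ultimately show "\<exists>g. path g \<and> path_image g \<subseteq> config_set X \<and> pathstart g = u \<and> pathfinish g = v"
    by blast
qed

section \<open>Conjugating paths\<close>

definition paths_from_to :: "'a::topological_space set \<Rightarrow> 'a \<Rightarrow> 'a \<Rightarrow> (real \<Rightarrow> 'a) set" where
  "paths_from_to S a b =
     {p. path p \<and> path_image p \<subseteq> S \<and> pathstart p = a \<and> pathfinish p = b}"

lemma paths_from_to_join:
  "p \<in> paths_from_to S a b \<Longrightarrow> q \<in> paths_from_to S b c \<Longrightarrow> p +++ q \<in> paths_from_to S a c"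
  by (simp add: paths_from_to_def path_image_join)

lemma paths_from_to_reverse:
  "p \<in> paths_from_to S a b \<Longrightarrow> reversepath p \<in> paths_from_to S b a"
  by (simp add: paths_from_to_def)

lemma paths_from_to_image:
  "p \<in> paths_from_to S a b \<Longrightarrow> continuous_on S F \<Longrightarrow> F ` S \<subseteq> S' \<Longrightarrow>
    F \<circ> p \<in> paths_from_to S' (F a) (F b)"
  by (auto simp: paths_from_to_def path_image_compose pathstart_compose pathfinish_compose
      intro: path_continuous_image continuous_on_subset)

lemma homotopic_paths_refl_from_to: "p \<in> paths_from_to S a b \<Longrightarrow> homotopic_paths S p p"
  by (simp add: paths_from_to_def)

lemma homotopic_paths_join_from_to:
  "homotopic_paths S p p' \<Longrightarrow> homotopic_paths S q q' \<Longrightarrow> p \<in> paths_from_to S a b \<Longrightarrow>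
    q \<in> paths_from_to S b c \<Longrightarrow> homotopic_paths S (p +++ q) (p' +++ q')"
  by (simp add: homotopic_paths_join paths_from_to_def)

lemma homotopic_paths_assoc_from_to:
  "p \<in> paths_from_to S a b \<Longrightarrow> q \<in> paths_from_to S b c \<Longrightarrow> r \<in> paths_from_to S c d \<Longrightarrow>
    homotopic_paths S ((p +++ q) +++ r) (p +++ (q +++ r))"
  by (rule homotopic_paths_sym, rule homotopic_paths_assoc) (simp_all add: paths_from_to_def)

lemma homotopic_paths_const_join:
  assumes "path q" "path_image q \<subseteq> S"
  shows "homotopic_paths S ((\<lambda>t. pathstart q) +++ q) q"
proof (rule homotopic_paths_sym,
    rule homotopic_paths_reparametrize[OF assms, of "\<lambda>t. max 0 (2*t - 1)"])
  show "continuous_on {0..1} (\<lambda>t::real. max 0 (2*t - 1))"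
    by (intro continuous_intros)
  show "(\<lambda>t::real. max 0 (2*t - 1)) \<in> {0..1} \<rightarrow> {0..1}" by (auto simp: max_def)
  show "((\<lambda>t. pathstart q) +++ q) t = q (max 0 (2*t - 1))" for t
  proof (cases "t \<le> 1/2")
    case True
    then have "max 0 (2*t - 1) = 0" by (simp add: max_def)
    then show ?thesis using True by (simp add: joinpaths_def pathstart_def)
  next
    case False
    then have "max 0 (2*t - 1) = 2*t - 1" by (simp add: max_def)
    then show ?thesis using False by (simp add: joinpaths_def)
  qed
qed simp_all

text \<open>
  The cancellation laws of the fundamental groupoid, for arbitrary topological spaces: the product
  topology on \<open>complex \<Rightarrow> complex\<close> does not come from a norm.
\<close>

lemma homotopic_paths_cancel_left:
  assumes p: "p \<in> paths_from_to S a b" and q: "q \<in> paths_from_to S b c"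
  shows "homotopic_paths S (reversepath p +++ (p +++ q)) q"
proof -
  note r = paths_from_to_reverse[OF p]
  have "homotopic_paths S (reversepath p +++ (p +++ q)) ((reversepath p +++ p) +++ q)"
    by (rule homotopic_paths_sym[OF homotopic_paths_assoc_from_to[OF r p q]])
  also have "homotopic_paths S ((reversepath p +++ p) +++ q) ((\<lambda>t. pathstart q) +++ q)"
    using homotopic_paths_reversepath_join[of p S] p q
    by (intro homotopic_paths_join_from_to[OF _ _ paths_from_to_join[OF r p] q])
      (simp_all add: paths_from_to_def)
  also have "homotopic_paths S ((\<lambda>t. pathstart q) +++ q) q"
    using q by (intro homotopic_paths_const_join) (simp_all add: paths_from_to_def)
  finally show ?thesis .
qed

lemma homotopic_paths_cancel_left':
  assumes p: "p \<in> paths_from_to S a b" and q: "q \<in> paths_from_to S a c"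
  shows "homotopic_paths S (p +++ (reversepath p +++ q)) q"
  using homotopic_paths_cancel_left[OF paths_from_to_reverse[OF p] q] by simp

lemma homotopic_paths_cancel_right:
  assumes p: "p \<in> paths_from_to S a b" and q: "q \<in> paths_from_to S b c"
  shows "homotopic_paths S ((p +++ q) +++ reversepath q) p"
proof -
  have "reversepath ((p +++ q) +++ reversepath q) = q +++ (reversepath q +++ reversepath p)"
    using p q by (simp add: reversepath_joinpaths paths_from_to_def)
  then show ?thesis
    using homotopic_paths_cancel_left'[OF q paths_from_to_reverse[OF p]]
    by (metis homotopic_paths_reversepath)
qed

lemma homotopic_paths_cancel_right':
  assumes p: "p \<in> paths_from_to S a c" and q: "q \<in> paths_from_to S b c"
  shows "homotopic_paths S ((p +++ reversepath q) +++ q) p"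
  using homotopic_paths_cancel_right[OF p paths_from_to_reverse[OF q]] by simp

text \<open>
  Two connecting paths are needed because the ends of a braid differ: \<open>h\<close> moves its start and \<open>k\<close>
  its finish.
\<close>

definition conj_path :: "(real \<Rightarrow> 'a) \<Rightarrow> (real \<Rightarrow> 'a) \<Rightarrow> (real \<Rightarrow> 'a) \<Rightarrow> real \<Rightarrow> 'a::topological_space"
  where "conj_path h k f = reversepath h +++ (f +++ k)"

lemma conj_path_from_to:
  "h \<in> paths_from_to S a a' \<Longrightarrow> k \<in> paths_from_to S b b' \<Longrightarrow> f \<in> paths_from_to S a b \<Longrightarrow>
    conj_path h k f \<in> paths_from_to S a' b'"
  unfolding conj_path_def by (metis paths_from_to_join paths_from_to_reverse)

lemma homotopic_paths_conj_path_iff: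
  assumes h: "h \<in> paths_from_to S a a'" and k: "k \<in> paths_from_to S b b'"
    and f: "f \<in> paths_from_to S a b" and g: "g \<in> paths_from_to S a b"
  shows "homotopic_paths S (conj_path h k f) (conj_path h k g) \<longleftrightarrow> homotopic_paths S f g"
proof
  assume "homotopic_paths S f g"
  then show "homotopic_paths S (conj_path h k f) (conj_path h k g)"
    unfolding conj_path_def
    by (intro homotopic_paths_join_from_to[OF _ _ paths_from_to_reverse[OF h] paths_from_to_join[OF f k]]
        homotopic_paths_join_from_to[OF _ _ f k] homotopic_paths_refl_from_to[OF paths_from_to_reverse[OF h]]
        homotopic_paths_refl_from_to[OF k])
next
  have undo: "homotopic_paths S ((h +++ conj_path h k p) +++ reversepath k) p"
    if p: "p \<in> paths_from_to S a b" for p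
  proof -
    have "homotopic_paths S ((h +++ conj_path h k p) +++ reversepath k) ((p +++ k) +++ reversepath k)"
      unfolding conj_path_def
      by (meson h k p homotopic_paths_join_from_to homotopic_paths_cancel_left'
          homotopic_paths_refl_from_to paths_from_to_join paths_from_to_reverse)
    also have "homotopic_paths S ((p +++ k) +++ reversepath k) p"
      by (rule homotopic_paths_cancel_right[OF p k])
    finally show ?thesis .
  qed
  assume *: "homotopic_paths S (conj_path h k f) (conj_path h k g)"
  have "homotopic_paths S f ((h +++ conj_path h k f) +++ reversepath k)"
    by (rule homotopic_paths_sym[OF undo[OF f]])
  also have "homotopic_paths S \<dots> ((h +++ conj_path h k g) +++ reversepath k)"
    by (meson h k f * homotopic_paths_join_from_to conj_path_from_to
        homotopic_paths_refl_from_to paths_from_to_join paths_from_to_reverse)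
  also have "homotopic_paths S \<dots> g" by (rule undo[OF g])
  finally show "homotopic_paths S f g" .
qed

lemma homotopic_paths_conj_path_join:
  assumes h: "h \<in> paths_from_to S a a'" and k: "k \<in> paths_from_to S b b'"
    and l: "l \<in> paths_from_to S c c'"
    and f: "f \<in> paths_from_to S a b" and g: "g \<in> paths_from_to S b c"
  shows "homotopic_paths S (conj_path h k f +++ conj_path k l g) (conj_path h l (f +++ g))"
proof -
  note J = paths_from_to_join and R = paths_from_to_reverse
  note gl = J[OF g l] and fk = J[OF f k]
  note kgl = J[OF R[OF k] gl]
  have "homotopic_paths S (conj_path h k f +++ conj_path k l g)
      (reversepath h +++ ((f +++ k) +++ (reversepath k +++ (g +++ l))))"
    unfolding conj_path_def by (rule homotopic_paths_assoc_from_to[OF R[OF h] fk kgl])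
  also have "homotopic_paths S \<dots> (reversepath h +++ ((f +++ g) +++ l))"
  proof (rule homotopic_paths_join_from_to[OF homotopic_paths_refl_from_to[OF R[OF h]] _ R[OF h] J[OF fk kgl]])
    have "homotopic_paths S ((f +++ k) +++ (reversepath k +++ (g +++ l)))
        (f +++ (k +++ (reversepath k +++ (g +++ l))))"
      by (rule homotopic_paths_assoc_from_to[OF f k kgl])
    also have "homotopic_paths S \<dots> (f +++ (g +++ l))"
      by (rule homotopic_paths_join_from_to[OF homotopic_paths_refl_from_to[OF f]
            homotopic_paths_cancel_left'[OF k gl] f J[OF k kgl]])
    also have "homotopic_paths S \<dots> ((f +++ g) +++ l)"
      by (rule homotopic_paths_sym[OF homotopic_paths_assoc_from_to[OF f g l]])
    finally show "homotopic_paths S ((f +++ k) +++ (reversepath k +++ (g +++ l))) ((f +++ g) +++ l)" .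
  qed
  finally show ?thesis by (simp add: conj_path_def)
qed

lemma conj_path_surj:
  assumes h: "h \<in> paths_from_to S a a'" and k: "k \<in> paths_from_to S b b'"
    and p: "p \<in> paths_from_to S a' b'"
  obtains f where "f \<in> paths_from_to S a b" "homotopic_paths S (conj_path h k f) p"
proof
  note J = paths_from_to_join and R = paths_from_to_reverse
  let ?q = "p +++ reversepath k"
  note q = J[OF p R[OF k]]
  show "h +++ ?q \<in> paths_from_to S a b" by (rule J[OF h q])
  have "homotopic_paths S (conj_path h k (h +++ ?q)) (reversepath h +++ (h +++ (?q +++ k)))"
    unfolding conj_path_def
    by (rule homotopic_paths_join_from_to[OF homotopic_paths_refl_from_to[OF R[OF h]]
          homotopic_paths_assoc_from_to[OF h q k] R[OF h] J[OF J[OF h q] k]])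
  also have "homotopic_paths S \<dots> (?q +++ k)"
    by (rule homotopic_paths_cancel_left[OF h J[OF q k]])
  also have "homotopic_paths S \<dots> p" by (rule homotopic_paths_cancel_right'[OF p k])
  finally show "homotopic_paths S (conj_path h k (h +++ ?q)) p" .
qed

section \<open>Carrying braids from one set to another\<close>

lemma compose_right_config_set:
  "bij_betw \<sigma> Z X \<Longrightarrow> (\<lambda>u. compose Z u \<sigma>) ` config_set X \<subseteq> config_set Z"
  by (auto simp: config_set_def compose_def inj_on_def bij_betw_def)

lemma paths_from_to_compose_right:
  assumes p: "p \<in> paths_from_to (config_set X) a b" and s: "bij_betw \<sigma> Z X"
  shows "(\<lambda>u. compose Z u \<sigma>) \<circ> p \<in> paths_from_to (config_set Z) (compose Z a \<sigma>) (compose Z b \<sigma>)"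
  by (rule paths_from_to_image[OF p continuous_on_compose_right compose_right_config_set[OF s]])

lemma homotopic_paths_compose_right:
  assumes p: "homotopic_paths (config_set X) p q" and s: "bij_betw \<sigma> Z X"
  shows "homotopic_paths (config_set Z) ((\<lambda>u. compose Z u \<sigma>) \<circ> p) ((\<lambda>u. compose Z u \<sigma>) \<circ> q)"
  by (rule homotopic_paths_continuous_image[OF p continuous_on_compose_right])
    (use compose_right_config_set[OF s] in blast)

text \<open>
  Composing with \<open>\<psi>\<close> and then \<open>\<phi>\<close> restores an extensional function.  The two paths
  are equal only on the unit interval: elsewhere the values of \<open>p\<close> need not be extensional.
\<close>

lemma homotopic_paths_compose_inverse:
  assumes p: "p \<in> paths_from_to (config_set X) a b"
    and inv: "\<And>x. x \<in> X \<Longrightarrow> \<phi> x \<in> Y" "\<And>x. x \<in> X \<Longrightarrow> \<psi> (\<phi> x) = x"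
  shows "homotopic_paths (config_set X) p ((\<lambda>u. compose X u \<phi>) \<circ> ((\<lambda>u. compose Y u \<psi>) \<circ> p))"
proof (rule homotopic_paths_eq)
  show "path p" "path_image p \<subseteq> config_set X" using p by (auto simp: paths_from_to_def)
  fix t :: real assume "t \<in> {0..1}"
  then have "p t \<in> extensional X"
    using p by (auto simp: paths_from_to_def path_image_def config_set_def image_subset_iff)
  then show "p t = ((\<lambda>u. compose X u \<phi>) \<circ> ((\<lambda>u. compose Y u \<psi>) \<circ> p)) t"
    using inv by (auto simp: compose_def fun_eq_iff extensional_def)
qed

lemma braids_iff_from_to:
  "f \<in> braids X \<longleftrightarrow> f \<in> paths_from_to (config_set X) (\<lambda>x\<in>X. x) (f 1) \<and> f 1 \<in> Bij X"
  by (auto simp: braids_iff paths_from_to_def pathfinish_def)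

lemma path_perm_from_to:
  assumes h: "h \<in> paths_from_to (config_set X) (\<lambda>x\<in>X. x) \<phi>" and s: "\<sigma> \<in> Bij X"
  shows "path_perm X h \<sigma> \<in> paths_from_to (config_set X) \<sigma> (compose X \<phi> \<sigma>)"
proof -
  have "compose X (\<lambda>x\<in>X. x) \<sigma> = \<sigma>"
    using s by (simp add: Bij_imp_funcset Bij_imp_extensional)
  then show ?thesis
    using paths_from_to_compose_right[OF h, of \<sigma> X] s by (simp add: path_perm_eq Bij_def)
qed

lemma path_perm_conj_path:
  "path_perm X (conj_path h k f) \<sigma> = conj_path (path_perm X h \<sigma>) (path_perm X k \<sigma>) (path_perm X f \<sigma>)"
  by (simp add: conj_path_def path_perm_join) (simp add: path_perm_def reversepath_def)

text \<open>
  Throughout, \<open>h\<close> leads from the identity of \<open>X\<close> to a bijection \<open>\<phi>\<close> onto \<open>Y\<close>, and \<open>\<psi>\<close> is the inverse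
  of \<open>\<phi>\<close>.
\<close>

context
  fixes X Y :: "complex set" and \<phi> \<psi> :: "complex \<Rightarrow> complex" and h :: "real \<Rightarrow> complex \<Rightarrow> complex"
  assumes bij: "bij_betw \<phi> X Y" and ext: "\<phi> \<in> extensional X"
    and psi: "\<psi> = (\<lambda>y\<in>Y. inv_into X \<phi> y)"
    and h: "h \<in> paths_from_to (config_set X) (\<lambda>x\<in>X. x) \<phi>"
begin

text \<open>
  The conjugate of \<open>f\<close> runs from \<open>\<phi>\<close> to \<open>\<phi> \<circ> f 1\<close>, both functions on \<open>X\<close>; composing with \<open>\<psi>\<close> on the
  right turns them into the identity and a permutation of \<open>Y\<close>.
\<close>

definition transport :: "(real \<Rightarrow> complex \<Rightarrow> complex) \<Rightarrow> real \<Rightarrow> complex \<Rightarrow> complex" where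
  "transport f = (\<lambda>u. compose Y u \<psi>) \<circ> conj_path h (path_perm X h (f 1)) f"

private lemma inverses:
  "x \<in> X \<Longrightarrow> \<phi> x \<in> Y" "y \<in> Y \<Longrightarrow> \<psi> y \<in> X"
  "x \<in> X \<Longrightarrow> \<psi> (\<phi> x) = x" "y \<in> Y \<Longrightarrow> \<phi> (\<psi> y) = y"
  using bij by (auto simp: psi bij_betw_def f_inv_into_f inv_into_into)

private lemma bij_psi: "bij_betw \<psi> Y X"
  by (rule bij_betwI[of _ _ _ \<phi>]) (use inverses in auto)

private lemma compose_phi_psi: "compose Y \<phi> \<psi> = (\<lambda>y\<in>Y. y)"
  using inverses by (auto simp: compose_def)

lemma conj_h_from_to:
  assumes "f \<in> braids X"
  shows "conj_path h (path_perm X h (f 1)) f \<in> paths_from_to (config_set X) \<phi> (compose X \<phi> (f 1))"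
  using assms h unfolding braids_iff_from_to by (blast intro: conj_path_from_to path_perm_from_to)

lemma transport_from_to:
  assumes "f \<in> braids X"
  shows "transport f \<in> paths_from_to (config_set Y) (\<lambda>y\<in>Y. y) (compose Y (compose X \<phi> (f 1)) \<psi>)"
  using paths_from_to_compose_right[OF conj_h_from_to[OF assms] bij_psi]
  by (simp add: transport_def compose_phi_psi)

lemma transport_1:
  "f \<in> braids X \<Longrightarrow> transport f 1 = compose Y (compose X \<phi> (f 1)) \<psi>"
  using transport_from_to[of f] by (simp add: paths_from_to_def pathfinish_def)

lemma transport_braids:
  assumes f: "f \<in> braids X"
  shows "transport f \<in> braids Y"
proof -
  have "bij_betw (f 1) X X" using f by (simp add: braids_def Bij_def)
  then have "bij_betw (\<phi> \<circ> (f 1 \<circ> \<psi>)) Y Y" using bij bij_psi by (blast intro: bij_betw_trans)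
  then have "bij_betw (compose Y (compose X \<phi> (f 1)) \<psi>) Y Y"
    by (rule bij_betw_cong[THEN iffD1, rotated]) (simp add: compose_def inverses)
  then have "compose Y (compose X \<phi> (f 1)) \<psi> \<in> Bij Y" by (simp add: Bij_def)
  then show ?thesis
    using transport_from_to[OF f] by (simp add: braids_iff_from_to transport_1[OF f])
qed

text \<open>
  A homotopy between transported braids is pulled back through \<open>\<phi>\<close> and unconjugated.  The latter
  needs the same final connecting path for \<open>f\<close> and \<open>g\<close>, that is, \<open>f 1 = g 1\<close>; this follows by
  comparing the ends of the conjugates and cancelling \<open>\<phi>\<close>.
\<close>

lemma homotopic_paths_transport_iff:
  assumes f: "f \<in> braids X" and g: "g \<in> braids X"
  shows "homotopic_paths (config_set Y) (transport f) (transport g) \<longleftrightarrow>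
    homotopic_paths (config_set X) f g" (is "?L \<longleftrightarrow> ?R")
proof -
  let ?c = "\<lambda>f. conj_path h (path_perm X h (f 1)) f"
  have f': "f \<in> paths_from_to (config_set X) (\<lambda>x\<in>X. x) (f 1)" "f 1 \<in> Bij X"
    and g': "g \<in> paths_from_to (config_set X) (\<lambda>x\<in>X. x) (g 1)" "g 1 \<in> Bij X"
    using f g by (simp_all add: braids_iff_from_to)
  have iff: "homotopic_paths (config_set X) (?c f) (?c g) \<longleftrightarrow> ?R" if eq: "g 1 = f 1"
    using homotopic_paths_conj_path_iff[OF h path_perm_from_to[OF h f'(2)] f'(1), of g] g' eq by simp
  show ?thesis
  proof
    assume R: ?R
    then have "g 1 = f 1" using homotopic_paths_imp_pathfinish[OF R] by (simp add: pathfinish_def)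
    then show ?L
      unfolding transport_def using R iff bij_psi by (blast intro: homotopic_paths_compose_right)
  next
    assume L: ?L
    have undo: "homotopic_paths (config_set X) (?c f) ((\<lambda>u. compose X u \<phi>) \<circ> transport f)"
      if "f \<in> braids X" for f
      unfolding transport_def
      by (rule homotopic_paths_compose_inverse[OF conj_h_from_to[OF that]]) (simp_all add: inverses)
    have "homotopic_paths (config_set X) (?c f) ((\<lambda>u. compose X u \<phi>) \<circ> transport f)" by (rule undo[OF f])
    also have "homotopic_paths (config_set X) \<dots> ((\<lambda>u. compose X u \<phi>) \<circ> transport g)"
      by (rule homotopic_paths_compose_right[OF L bij])
    also have "homotopic_paths (config_set X) \<dots> (?c g)" by (rule homotopic_paths_sym[OF undo[OF g]])
    finally have c: "homotopic_paths (config_set X) (?c f) (?c g)" .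
    have "compose X \<phi> (f 1) = compose X \<phi> (g 1)"
      using homotopic_paths_imp_pathfinish[OF c] conj_h_from_to[OF f] conj_h_from_to[OF g]
      by (simp add: paths_from_to_def)
    then have "\<phi> (f 1 x) = \<phi> (g 1 x)" if "x \<in> X" for x
      using that by (metis compose_eq)
    moreover have "f 1 x \<in> X" "g 1 x \<in> X" if "x \<in> X" for x
      using that f'(2) g'(2) by (auto dest!: Bij_imp_funcset)
    ultimately have "g 1 x = f 1 x" if "x \<in> X" for x
      using that inverses(3) by metis
    then have "g 1 = f 1"
      using f'(2) g'(2) by (meson Bij_imp_extensional extensionalityI)
    then show ?R using c iff by blast
  qed
qed

text \<open>
  Put \<open>\<sigma> = f 1\<close> and \<open>\<rho> = g 1 \<circ> f 1\<close>.  Permuting the transport of \<open>g\<close> by the end of the transport of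
  \<open>f\<close> amounts to permuting by \<open>\<sigma>\<close> before relabelling, because \<open>\<psi> \<circ> (\<phi> \<circ> \<sigma> \<circ> \<psi>) = \<sigma> \<circ> \<psi>\<close>.  So the second
  factor is the conjugate of the permuted \<open>g\<close> between the connecting paths at \<open>\<sigma>\<close> and \<open>\<rho>\<close>, and the
  connecting path at \<open>\<sigma>\<close> cancels against the one at the end of the first factor.
\<close>

lemma homotopic_paths_transport_join:
  assumes f: "f \<in> braids X" and g: "g \<in> braids X"
  shows "homotopic_paths (config_set Y) (transport f +++ path_perm Y (transport g) (transport f 1))
    (transport (f +++ path_perm X g (f 1)))"
proof -
  let ?R = "\<lambda>u. compose Y u \<psi>" and ?S = "config_set X"
  define \<sigma> \<rho> where "\<sigma> = f 1" and "\<rho> = compose X (g 1) (f 1)"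
  have s: "\<sigma> \<in> Bij X" and g1: "g 1 \<in> Bij X" and r: "\<rho> \<in> Bij X"
    using f g by (auto simp: \<sigma>_def \<rho>_def braids_def intro: compose_Bij)
  have sX: "\<sigma> x \<in> X" if "x \<in> X" for x
    using that s by (auto dest!: Bij_imp_funcset)
  define k l where "k = path_perm X h \<sigma>" and "l = path_perm X h \<rho>"
  have k: "k \<in> paths_from_to ?S \<sigma> (compose X \<phi> \<sigma>)" and l: "l \<in> paths_from_to ?S \<rho> (compose X \<phi> \<rho>)"
    unfolding k_def l_def using s r by (auto intro: path_perm_from_to h)
  have f': "f \<in> paths_from_to ?S (\<lambda>x\<in>X. x) \<sigma>"
    using f by (simp add: braids_iff_from_to \<sigma>_def)
  have g': "path_perm X g \<sigma> \<in> paths_from_to ?S \<sigma> \<rho>"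
    using path_perm_from_to[of g X "g 1" \<sigma>] g s by (simp add: braids_iff_from_to \<sigma>_def \<rho>_def)
  have tf: "transport f = ?R \<circ> conj_path h k f"
    by (simp add: transport_def k_def \<sigma>_def)
  have perm: "path_perm Y (?R \<circ> p) (transport f 1) = ?R \<circ> path_perm X p \<sigma>" for p
    unfolding transport_1[OF f]
    using sX by (auto simp: path_perm_def compose_def fun_eq_iff inverses \<sigma>_def)
  have "path_perm X (path_perm X h (g 1)) \<sigma> = l"
    using s by (simp add: path_perm_path_perm l_def \<rho>_def \<sigma>_def)
  then have tg: "path_perm Y (transport g) (transport f 1) = ?R \<circ> conj_path k l (path_perm X g \<sigma>)"
    unfolding transport_def[of g] perm path_perm_conj_path by (simp add: k_def)
  have "(f +++ path_perm X g \<sigma>) 1 = \<rho>"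
    by (simp add: joinpaths_def path_perm_eq \<rho>_def \<sigma>_def)
  then have tfg: "transport (f +++ path_perm X g \<sigma>) = ?R \<circ> conj_path h l (f +++ path_perm X g \<sigma>)"
    by (simp add: transport_def l_def)
  have "homotopic_paths (config_set Y) (?R \<circ> (conj_path h k f +++ conj_path k l (path_perm X g \<sigma>)))
      (?R \<circ> conj_path h l (f +++ path_perm X g \<sigma>))"
    by (rule homotopic_paths_compose_right[OF homotopic_paths_conj_path_join[OF h k l f' g'] bij_psi])
  then show ?thesis
    using tf tg tfg by (simp add: path_compose_join \<sigma>_def)
qed

lemma transport_surj:
  assumes g: "g \<in> braids Y"
  obtains f where "f \<in> braids X" "homotopic_paths (config_set Y) (transport f) g"
proof -
  let ?R = "\<lambda>u. compose Y u \<psi>" and ?Q = "\<lambda>u. compose X u \<phi>"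
  define \<sigma> where "\<sigma> = compose X (\<psi> \<circ> g 1) \<phi>"
  have g': "g \<in> paths_from_to (config_set Y) (\<lambda>y\<in>Y. y) (g 1)" and b: "bij_betw (g 1) Y Y"
    using g by (simp_all add: braids_iff_from_to Bij_def)
  have "bij_betw ((\<psi> \<circ> g 1) \<circ> \<phi>) X X"
    using b bij bij_psi by (blast intro: bij_betw_trans)
  then have "bij_betw \<sigma> X X"
    by (rule bij_betw_cong[THEN iffD1, rotated]) (simp add: \<sigma>_def compose_def)
  then have s: "\<sigma> \<in> Bij X" by (simp add: Bij_def \<sigma>_def)
  have "g 1 y \<in> Y" if "y \<in> Y" for y using b that by (auto simp: bij_betw_def)
  then have "?Q (\<lambda>y\<in>Y. y) = \<phi>" "?Q (g 1) = compose X \<phi> \<sigma>"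
    using ext by (auto simp: compose_def \<sigma>_def fun_eq_iff inverses extensional_def)
  then have "?Q \<circ> g \<in> paths_from_to (config_set X) \<phi> (compose X \<phi> \<sigma>)"
    using paths_from_to_compose_right[OF g' bij] by simp
  then obtain f where f: "f \<in> paths_from_to (config_set X) (\<lambda>x\<in>X. x) \<sigma>"
    and hom: "homotopic_paths (config_set X) (conj_path h (path_perm X h \<sigma>) f) (?Q \<circ> g)"
    using conj_path_surj[OF h path_perm_from_to[OF h s]] by blast
  have f1: "f 1 = \<sigma>" using f by (simp add: paths_from_to_def pathfinish_def)
  show thesis
  proof
    show "f \<in> braids X" using f f1 s by (simp add: braids_iff_from_to)
    have "homotopic_paths (config_set Y) (transport f) (?R \<circ> (?Q \<circ> g))"
      using homotopic_paths_compose_right[OF hom bij_psi] by (simp add: transport_def f1)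
    also have "homotopic_paths (config_set Y) \<dots> g"
      by (rule homotopic_paths_sym[OF homotopic_paths_compose_inverse[OF g']])
        (simp_all add: inverses)
    finally show "homotopic_paths (config_set Y) (transport f) g" .
  qed
qed

lemma braid_group_iso: "braid_group X \<cong> braid_group Y"
proof -
  define F where "F P = braid_class Y (transport (SOME f. f \<in> P))" for P
  have car: "carrier (braid_group Z) = braid_class Z ` braids Z" for Z
    by (simp add: braid_group_def)
  have F: "F (braid_class X f) = braid_class Y (transport f)" if f: "f \<in> braids X" for f
  proof -
    define f' where "f' = (SOME f'. f' \<in> braid_class X f)"
    have "f \<in> braid_class X f"
      using f by (simp add: braid_class_def path_hom_config_space braids_iff)
    then have "f' \<in> braid_class X f" unfolding f'_def by (metis someI)
    then have f': "f' \<in> braids X" "homotopic_paths (config_set X) f f'"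
      by (simp_all add: braid_class_def path_hom_config_space)
    then have "homotopic_paths (config_set Y) (transport f') (transport f)"
      using homotopic_paths_transport_iff[OF f'(1) f] by (simp add: homotopic_paths_sym)
    then have "braid_class Y (transport f') = braid_class Y (transport f)"
      by (simp add: braid_class_eq_iff transport_braids f f')
    then show ?thesis by (simp add: F_def f'_def)
  qed
  have "F \<in> iso (braid_group X) (braid_group Y)"
    unfolding iso_iff
  proof (intro conjI)
    show "F \<in> hom (braid_group X) (braid_group Y)"
    proof (rule homI)
      show "F P \<in> carrier (braid_group Y)" if "P \<in> carrier (braid_group X)" for P
        using that by (auto simp: car F transport_braids)
      show "F (P \<otimes>\<^bsub>braid_group X\<^esub> Q) = F P \<otimes>\<^bsub>braid_group Y\<^esub> F Q"
        if PQ: "P \<in> carrier (braid_group X)" "Q \<in> carrier (braid_group X)" for P Q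
      proof -
        obtain f g where f: "f \<in> braids X" and P: "P = braid_class X f"
          and g: "g \<in> braids X" and Q: "Q = braid_class X g"
          using PQ by (auto simp: car)
        have "braid_class Y (transport (f +++ path_perm X g (f 1))) =
            braid_class Y (transport f +++ path_perm Y (transport g) (transport f 1))"
          using homotopic_paths_transport_join[OF f g]
          by (simp add: braid_class_eq_iff transport_braids join_braids f g homotopic_paths_sym)
        then show ?thesis
          by (simp add: P Q f g mult_braid_class F join_braids transport_braids)
      qed
    qed
    show "inj_on F (carrier (braid_group X))"
      by (auto simp: inj_on_def car F braid_class_eq_iff transport_braids homotopic_paths_transport_iff)
    show "F ` carrier (braid_group X) = carrier (braid_group Y)"
    proof (intro equalityI subsetI)
      fix Q assume "Q \<in> carrier (braid_group Y)"
      then obtain g where g: "g \<in> braids Y" and Q: "Q = braid_class Y g" by (auto simp: car)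
      obtain f where f: "f \<in> braids X" and "homotopic_paths (config_set Y) (transport f) g"
        using transport_surj[OF g] .
      then have "Q = F (braid_class X f)"
        by (simp add: Q F g braid_class_eq_iff transport_braids homotopic_paths_sym)
      then show "Q \<in> F ` carrier (braid_group X)" using f by (simp add: car)
    qed (auto simp: car F transport_braids)
  qed
  then show ?thesis by (rule is_isoI)
qed

end

theorem theorem2p2:
  fixes X Y :: "complex set"
  assumes "X \<approx> Y"
  shows "braid_group X \<cong> braid_group Y"
proof -
  obtain \<phi>' where \<phi>': "bij_betw \<phi>' X Y" using assms by (auto simp: eqpoll_def)
  define \<phi> where "\<phi> = restrict \<phi>' X"
  have bij: "bij_betw \<phi> X Y" using \<phi>' by (simp add: \<phi>_def)
  have ext: "\<phi> \<in> extensional X" by (simp add: \<phi>_def)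
  have "(\<lambda>x\<in>X. x) \<in> config_set X" "\<phi> \<in> config_set X"
    using bij ext by (auto simp: config_set_def bij_betw_def inj_on_def)
  then obtain h where "h \<in> paths_from_to (config_set X) (\<lambda>x\<in>X. x) \<phi>"
    using path_connected_config_set unfolding path_connected_def paths_from_to_def by blast
  then show ?thesis using braid_group_iso[OF bij ext refl] by blast
qed

end
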